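(* Let $T:E\to F$ be a positive $DW$-DP operator between Banach lattices $E$ and $F$. Let $W\subset E$ and $V\subset F'$ be two disjointly weakly compact sets. Then the following statements hold: (1) For every disjoint sequence $(x_n)$ in the solid hull $Sol(W)$ of $W$, the sequence $(Tx_n)$ converges uniformly to zero on the solid hull $Sol(V)$ of $V$, i.e. $\sup_{f\in Sol(V)}|f(Tx_n)|\to 0$ as $n\to\infty$. (2) For each $\epsilon>0$ there exists some $u\in E^+$ satisfying $\langle |f|, T[(|x|-u)^+]\rangle<\epsilon$ for all $x\in W$ and all $f\in V$.
   Context: All Banach spaces and Banach lattices are real; $X'$ is the topological dual of $X$, and $F'$ is regarded as a Banach lattice with its dual order. $E^+$ is the positive cone of $E$. For a subset $A$ of a Banach lattice $E$, $Sol(A)=\{y\in E: |y|\le |x| \text{ for some } x\in A\}$. A sequence $(x_n)$ is disjoint if $|x_n|\wedge|x_m|=0$ for $n\ne m$. A bounded subset $A$ of a Banach lattice is disjointly weakly compact if every disjoint sequence in $Sol(A)$ converges weakly to zero. A bounded subset $A$ of a Banach space $X$ is a Dunford-Pettis set if $\sup_{x\in A}|f_n(x)|\to 0$ for every weakly null sequence $(f_n)$ in $X'$. A bounded linear operator $T:E\to X$ from a Banach lattice to a Banach space is $DW$-DP if $T(A)$ is a Dunford-Pettis set for each disjointly weakly compact subset $A$ of $E$. *)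

theory Defs
  imports "HOL-Analysis.Analysis" "HOL-Library.Lattice_Algebras"
begin

class banach_lattice = banach + ordered_real_vector + lattice_ab_group_add_abs +
  assumes norm_mono_abs: "\<bar>x\<bar> \<le> \<bar>y\<bar> \<Longrightarrow> norm x \<le> norm y"

text \<open>Dedekind complete Banach lattices whose closed unit ball is an order interval
  \<open>[-e, e]\<close>. The only instance used for duals is \<^typ>\<open>real\<close>; the class exists because
  a type class instance cannot be declared for the type \<open>'a \<Rightarrow>\<^sub>L real\<close> alone. For such a
  codomain all bounded operators form a Banach lattice under the operator norm.\<close>

class complete_unit_banach_lattice = banach_lattice + conditionally_complete_lattice +
  assumes ex_order_unit: "\<exists>e. \<forall>x. norm x \<le> 1 \<longleftrightarrow> \<bar>x\<bar> \<le> e"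

instance real :: complete_unit_banach_lattice
proof
  show "\<exists>e. \<forall>x::real. norm x \<le> 1 \<longleftrightarrow> \<bar>x\<bar> \<le> e"
    by (rule exI[of _ 1]) simp
qed simp


subsection \<open>The dual of a Banach lattice as a Banach lattice\<close>

lemma order_unit_norm:
  "\<exists>e :: 'b::complete_unit_banach_lattice. 0 \<le> e \<and>
    (\<forall>c y. 0 \<le> c \<longrightarrow> (norm y \<le> c \<longleftrightarrow> \<bar>y\<bar> \<le> c *\<^sub>R e))"
proof -
  obtain e :: 'b where e: "\<And>x. norm x \<le> 1 \<longleftrightarrow> \<bar>x\<bar> \<le> e"
    using ex_order_unit by blast
  have e0: "0 \<le> e" using e[of 0] by simp
  have e1: "norm e \<le> 1" using e[of e] e0 by simp
  have "norm y \<le> c \<longleftrightarrow> \<bar>y\<bar> \<le> c *\<^sub>R e" if c: "0 \<le> c" for c and y :: 'b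
  proof
    assume y: "norm y \<le> c"
    show "\<bar>y\<bar> \<le> c *\<^sub>R e"
    proof (cases "c = 0")
      case True
      then show ?thesis using y by simp
    next
      case False
      then have c: "c > 0" using c by simp
      let ?z = "(1/c) *\<^sub>R y"
      have "norm ?z \<le> 1" using y c by (simp add: field_simps)
      then have z: "\<bar>?z\<bar> \<le> e" using e by blast
      have yz: "y = c *\<^sub>R ?z" using c by simp
      have "?z \<le> e" "- ?z \<le> e" using z by (simp_all add: abs_le_iff)
      then have "c *\<^sub>R ?z \<le> c *\<^sub>R e" "c *\<^sub>R (- ?z) \<le> c *\<^sub>R e"
        using c by (metis scaleR_left_mono less_imp_le)+
      then have "y \<le> c *\<^sub>R e" "- y \<le> c *\<^sub>R e" using c by simp_all
      then show ?thesis by (simp add: abs_le_iff)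
    qed
  next
    assume y: "\<bar>y\<bar> \<le> c *\<^sub>R e"
    have "0 \<le> c *\<^sub>R e" using c e0 by (simp add: scaleR_nonneg_nonneg)
    then have "norm y \<le> norm (c *\<^sub>R e)" using y by (intro norm_mono_abs) simp
    also have "\<dots> \<le> c" using c e1 by (simp add: mult_left_le)
    finally show "norm y \<le> c" .
  qed
  with e0 show ?thesis by blast
qed

lemma riesz_decomposition:
  fixes x y z :: "'a::lattice_ab_group_add"
  assumes "0 \<le> x" "0 \<le> y" "0 \<le> z" "z \<le> x + y"
  obtains z1 z2 where "z = z1 + z2" "z1 \<in> {0..x}" "z2 \<in> {0..y}"
proof
  show "z = inf z x + (z - inf z x)" by (metis add.commute diff_add_cancel)
  show "inf z x \<in> {0..x}" using assms by simp
  have "z - inf z x = sup 0 (z - x)" 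
    by (metis add_sup_distrib_left diff_inf_eq_sup add.right_inverse diff_conv_add_uminus)
  then show "z - inf z x \<in> {0..y}" using assms by (simp add: diff_le_eq add.commute)
qed

lemma pprt_diff_eq: "pprt x - pprt (- x) = (x::'a::lattice_ab_group_add)"
  using prts[of x] by (simp add: pprt_neg)

lemma norm_pprt_le: "norm (pprt x) \<le> norm (x::'a::banach_lattice)"
proof (rule norm_mono_abs)
  have "pprt x \<le> \<bar>x\<bar>"
    unfolding pprt_def by (intro sup_least abs_ge_self abs_ge_zero)
  then show "\<bar>pprt x\<bar> \<le> \<bar>x\<bar>" by simp
qed

definition blinfun_sup_interval ::
    "('a::banach_lattice \<Rightarrow>\<^sub>L 'b::complete_unit_banach_lattice) \<Rightarrow> 'a \<Rightarrow> 'b"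
  where "blinfun_sup_interval f x = (SUP y\<in>{0..x}. blinfun_apply f y)"

text \<open>Riesz--Kantorovich formula for the positive part, extended from the cone by linearity.\<close>

definition blinfun_pprt ::
    "('a::banach_lattice \<Rightarrow>\<^sub>L 'b::complete_unit_banach_lattice) \<Rightarrow> 'a \<Rightarrow>\<^sub>L 'b"
  where "blinfun_pprt f =
    Blinfun (\<lambda>x. blinfun_sup_interval f (pprt x) - blinfun_sup_interval f (pprt (- x)))"

context
  fixes f :: "'a::banach_lattice \<Rightarrow>\<^sub>L 'b::complete_unit_banach_lattice"
begin

lemma norm_blinfun_interval: "y \<in> {0..x} \<Longrightarrow> norm (blinfun_apply f y) \<le> norm f * norm x"
proof -
  assume y: "y \<in> {0..x}"
  then have "norm y \<le> norm x" by (intro norm_mono_abs) auto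
  then show ?thesis
    by (meson norm_blinfun norm_ge_zero mult_left_mono order_trans)
qed

lemma bdd_above_interval: "bdd_above (blinfun_apply f ` {0..x})"
proof -
  obtain e :: 'b where "0 \<le> e" and e: "\<And>c y. 0 \<le> c \<Longrightarrow> norm y \<le> c \<longleftrightarrow> \<bar>y\<bar> \<le> c *\<^sub>R e"
    using order_unit_norm by blast
  have "blinfun_apply f y \<le> (norm f * norm x) *\<^sub>R e" if "y \<in> {0..x}" for y
  proof -
    from norm_blinfun_interval[OF that] have "\<bar>blinfun_apply f y\<bar> \<le> (norm f * norm x) *\<^sub>R e"
      using e[of "norm f * norm x" "blinfun_apply f y"] by simp
    then show ?thesis by (rule abs_le_D1)
  qed
  then show ?thesis by (rule bdd_aboveI2)
qed

lemma sup_interval_upper: "y \<in> {0..x} \<Longrightarrow> blinfun_apply f y \<le> blinfun_sup_interval f x"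
  unfolding blinfun_sup_interval_def
  by (rule cSUP_upper) (auto intro: bdd_above_interval)

lemma sup_interval_least:
  assumes "0 \<le> x" "\<And>y. y \<in> {0..x} \<Longrightarrow> blinfun_apply f y \<le> c"
  shows "blinfun_sup_interval f x \<le> c"
  unfolding blinfun_sup_interval_def
  using assms by (intro cSUP_least) auto

lemma sup_interval_nonneg: "0 \<le> x \<Longrightarrow> 0 \<le> blinfun_sup_interval f x"
  using sup_interval_upper[of 0 x] by (simp add: blinfun.zero_right)

lemma sup_interval_add:
  assumes x: "0 \<le> x" and y: "0 \<le> y"
  shows "blinfun_sup_interval f (x + y) = blinfun_sup_interval f x + blinfun_sup_interval f y"
    (is "?l = ?p + ?q")
proof (rule order.antisym)
  show "?l \<le> ?p + ?q"
  proof (rule sup_interval_least)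
    show "0 \<le> x + y" using x y by simp
    fix z assume z: "z \<in> {0..x + y}"
    then obtain z1 z2 where *: "z = z1 + z2" "z1 \<in> {0..x}" "z2 \<in> {0..y}"
      using riesz_decomposition[of x y z] x y by auto
    then show "blinfun_apply f z \<le> ?p + ?q"
      using sup_interval_upper[OF *(2)] sup_interval_upper[OF *(3)]
      by (simp add: blinfun.add_right add_mono)
  qed
  have "?q \<le> ?l - blinfun_apply f a" if a: "a \<in> {0..x}" for a
  proof (rule sup_interval_least[OF y])
    fix b assume b: "b \<in> {0..y}"
    have "a + b \<in> {0..x + y}" using a b by (auto intro: add_mono)
    from sup_interval_upper[OF this]
    show "blinfun_apply f b \<le> ?l - blinfun_apply f a"
      by (simp add: blinfun.add_right le_diff_eq add.commute)
  qed
  then have "blinfun_apply f a \<le> ?l - ?q" if "a \<in> {0..x}" for a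
    using that by (simp add: le_diff_eq add.commute)
  from sup_interval_least[OF x this] show "?p + ?q \<le> ?l"
    by (simp add: le_diff_eq)
qed

lemma sup_interval_scaleR_le:
  assumes r: "0 < r" and x: "0 \<le> x"
  shows "blinfun_sup_interval f (r *\<^sub>R x) \<le> r *\<^sub>R blinfun_sup_interval f x"
proof (rule sup_interval_least)
  show "0 \<le> r *\<^sub>R x" using r x by (simp add: scaleR_nonneg_nonneg)
  fix y assume y: "y \<in> {0..r *\<^sub>R x}"
  then have "(1/r) *\<^sub>R y \<le> (1/r) *\<^sub>R (r *\<^sub>R x)" "0 \<le> (1/r) *\<^sub>R y"
    using r by (auto intro!: scaleR_left_mono scaleR_nonneg_nonneg simp del: scaleR_scaleR)
  then have "(1/r) *\<^sub>R y \<in> {0..x}" using r by simp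
  from scaleR_left_mono[OF sup_interval_upper[OF this], of r]
  show "blinfun_apply f y \<le> r *\<^sub>R blinfun_sup_interval f x"
    using r by (simp add: blinfun.scaleR_right)
qed

lemma sup_interval_zero: "blinfun_sup_interval f 0 = 0"
  by (simp add: blinfun_sup_interval_def blinfun.zero_right)

lemma sup_interval_scaleR:
  assumes r: "0 \<le> r" and x: "0 \<le> x"
  shows "blinfun_sup_interval f (r *\<^sub>R x) = r *\<^sub>R blinfun_sup_interval f x"
proof (cases "r = 0")
  case True
  then show ?thesis by (simp add: sup_interval_zero)
next
  case False
  then have r: "0 < r" using r by simp
  have "blinfun_sup_interval f ((1/r) *\<^sub>R (r *\<^sub>R x)) \<le> (1/r) *\<^sub>R blinfun_sup_interval f (r *\<^sub>R x)"
    using r x by (intro sup_interval_scaleR_le) (auto intro: scaleR_nonneg_nonneg)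
  then have "blinfun_sup_interval f x \<le> (1/r) *\<^sub>R blinfun_sup_interval f (r *\<^sub>R x)"
    using r by simp
  from scaleR_left_mono[OF this, of r]
  have "r *\<^sub>R blinfun_sup_interval f x \<le> blinfun_sup_interval f (r *\<^sub>R x)"
    using r by simp
  with sup_interval_scaleR_le[OF r x] show ?thesis by (rule order.antisym)
qed

lemma norm_sup_interval:
  assumes x: "0 \<le> x"
  shows "norm (blinfun_sup_interval f x) \<le> norm f * norm x"
proof -
  obtain e :: 'b where "0 \<le> e" and e: "\<And>c y. 0 \<le> c \<Longrightarrow> norm y \<le> c \<longleftrightarrow> \<bar>y\<bar> \<le> c *\<^sub>R e"
    using order_unit_norm by blast
  have "blinfun_sup_interval f x \<le> (norm f * norm x) *\<^sub>R e"
  proof (rule sup_interval_least[OF x])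
    fix y assume "y \<in> {0..x}"
    from norm_blinfun_interval[OF this] have "\<bar>blinfun_apply f y\<bar> \<le> (norm f * norm x) *\<^sub>R e"
      using e[of "norm f * norm x" "blinfun_apply f y"] by simp
    then show "blinfun_apply f y \<le> (norm f * norm x) *\<^sub>R e" by (rule abs_le_D1)
  qed
  then show ?thesis
    using e[of "norm f * norm x"] sup_interval_nonneg[OF x] by simp
qed

lemma blinfun_pprt_ext:
  assumes "0 \<le> a" "0 \<le> b"
  shows "blinfun_sup_interval f (pprt (a - b)) - blinfun_sup_interval f (pprt (- (a - b)))
    = blinfun_sup_interval f a - blinfun_sup_interval f b"
proof -
  have "pprt (a - b) + b = a + pprt (- (a - b))"
    using pprt_diff_eq[of "a - b"] by (simp add: algebra_simps)
  then have "blinfun_sup_interval f (pprt (a - b)) + blinfun_sup_interval f b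
    = blinfun_sup_interval f a + blinfun_sup_interval f (pprt (- (a - b)))"
    using assms by (metis sup_interval_add zero_le_pprt)
  then show ?thesis by (simp add: algebra_simps)
qed

lemma blinfun_pprt_apply:
  "blinfun_apply (blinfun_pprt f) x
    = blinfun_sup_interval f (pprt x) - blinfun_sup_interval f (pprt (- x))"
proof -
  let ?p = "blinfun_sup_interval f"
  let ?h = "\<lambda>x. ?p (pprt x) - ?p (pprt (- x))"
  have add: "?h (x + y) = ?h x + ?h y" for x y
  proof -
    have eq: "x + y = (pprt x + pprt y) - (pprt (- x) + pprt (- y))"
      by (simp only: add_diff_add pprt_diff_eq)
    have "?h (x + y) = ?p (pprt x + pprt y) - ?p (pprt (- x) + pprt (- y))"
      unfolding eq by (rule blinfun_pprt_ext) simp_all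
    then show ?thesis by (simp add: sup_interval_add)
  qed
  have scale: "?h (r *\<^sub>R x) = r *\<^sub>R ?h x" if r: "0 \<le> r" for r x
  proof -
    have eq: "r *\<^sub>R x = r *\<^sub>R pprt x - r *\<^sub>R pprt (- x)"
      by (simp only: pprt_diff_eq flip: scaleR_diff_right)
    have "?h (r *\<^sub>R x) = ?p (r *\<^sub>R pprt x) - ?p (r *\<^sub>R pprt (- x))"
      unfolding eq using r by (intro blinfun_pprt_ext) (simp_all add: scaleR_nonneg_nonneg)
    then show ?thesis using r by (simp add: sup_interval_scaleR scaleR_diff_right)
  qed
  have neg: "?h (- x) = - ?h x" for x by (simp only: minus_minus minus_diff_eq)
  have "bounded_linear ?h"
  proof (rule bounded_linear_intro)
    show "?h (r *\<^sub>R x) = r *\<^sub>R ?h x" for r x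
    proof (cases "0 \<le> r")
      case False
      then have *: "?h ((- r) *\<^sub>R x) = (- r) *\<^sub>R ?h x" by (intro scale) simp
      have "?h (r *\<^sub>R x) = ?h (- ((- r) *\<^sub>R x))"
        by (simp only: scaleR_minus_left minus_minus)
      also have "\<dots> = - ?h ((- r) *\<^sub>R x)" by (rule neg)
      also have "\<dots> = r *\<^sub>R ?h x" unfolding * by (simp only: scaleR_minus_left minus_minus)
      finally show ?thesis .
    qed (rule scale)
    show "norm (?h x) \<le> norm x * (2 * norm f)" for x
    proof -
      have "norm (?p (pprt x)) \<le> norm f * norm x" for x
        by (meson norm_sup_interval zero_le_pprt norm_pprt_le mult_left_mono norm_ge_zero order_trans)
      from this[of x] this[of "- x"] show ?thesis
        using norm_triangle_ineq4[of "?p (pprt x)" "?p (pprt (- x))"] by (simp add: algebra_simps)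
    qed
  qed (rule add)
  then show ?thesis unfolding blinfun_pprt_def by (simp add: bounded_linear_Blinfun_apply)
qed

lemma blinfun_pprt_pos: "0 \<le> x \<Longrightarrow> blinfun_apply (blinfun_pprt f) x = blinfun_sup_interval f x"
  by (simp add: blinfun_pprt_apply sup_interval_zero)

end

instantiation blinfun :: (banach_lattice, complete_unit_banach_lattice) banach_lattice
begin

text \<open>The dual order is the operator order; the lattice operations below are the suprema and
  infima for it, as the instance proof establishes.\<close>

definition less_eq_blinfun :: "'a \<Rightarrow>\<^sub>L 'b \<Rightarrow> 'a \<Rightarrow>\<^sub>L 'b \<Rightarrow> bool"
  where "f \<le> g \<longleftrightarrow> (\<forall>x\<ge>0. blinfun_apply f x \<le> blinfun_apply g x)"

definition less_blinfun :: "'a \<Rightarrow>\<^sub>L 'b \<Rightarrow> 'a \<Rightarrow>\<^sub>L 'b \<Rightarrow> bool"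
  where "f < g \<longleftrightarrow> f \<le> g \<and> \<not> g \<le> f" for f g :: "'a \<Rightarrow>\<^sub>L 'b"

definition sup_blinfun :: "'a \<Rightarrow>\<^sub>L 'b \<Rightarrow> 'a \<Rightarrow>\<^sub>L 'b \<Rightarrow> 'a \<Rightarrow>\<^sub>L 'b"
  where "sup f g = f + blinfun_pprt (g - f)"

definition inf_blinfun :: "'a \<Rightarrow>\<^sub>L 'b \<Rightarrow> 'a \<Rightarrow>\<^sub>L 'b \<Rightarrow> 'a \<Rightarrow>\<^sub>L 'b"
  where "inf f g = f - blinfun_pprt (f - g)"

definition abs_blinfun :: "'a \<Rightarrow>\<^sub>L 'b \<Rightarrow> 'a \<Rightarrow>\<^sub>L 'b"
  where "\<bar>f\<bar> = sup f (- f)" for f :: "'a \<Rightarrow>\<^sub>L 'b"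

instance
proof
  fix f g h :: "'a \<Rightarrow>\<^sub>L 'b" and r s :: real
  show "f < g \<longleftrightarrow> f \<le> g \<and> \<not> g \<le> f" by (rule less_blinfun_def)
  show "f \<le> f" by (simp add: less_eq_blinfun_def)
  show "f \<le> g \<Longrightarrow> g \<le> h \<Longrightarrow> f \<le> h" by (meson less_eq_blinfun_def order_trans)
  show "f = g" if "f \<le> g" "g \<le> f"
  proof (rule blinfun_eqI)
    fix x
    have "blinfun_apply f y = blinfun_apply g y" if "0 \<le> y" for y
      using \<open>f \<le> g\<close> \<open>g \<le> f\<close> that by (simp add: less_eq_blinfun_def order.antisym)
    then have "blinfun_apply f (pprt x - pprt (- x)) = blinfun_apply g (pprt x - pprt (- x))"
      by (simp add: blinfun.diff_right)
    then show "blinfun_apply f x = blinfun_apply g x" by (simp add: pprt_diff_eq)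
  qed
  have pprt_upper: "k \<le> blinfun_pprt k" "0 \<le> blinfun_pprt k" for k :: "'a \<Rightarrow>\<^sub>L 'b"
    by (simp_all add: less_eq_blinfun_def blinfun_pprt_pos sup_interval_upper sup_interval_nonneg)
  have pprt_least: "blinfun_pprt k \<le> h" if "k \<le> h" "0 \<le> h" for k h :: "'a \<Rightarrow>\<^sub>L 'b"
    unfolding less_eq_blinfun_def
  proof (intro allI impI)
    fix x :: 'a assume x: "0 \<le> x"
    have "blinfun_apply k y \<le> blinfun_apply h x" if y: "y \<in> {0..x}" for y
    proof -
      have "blinfun_apply k y \<le> blinfun_apply h y"
        using \<open>k \<le> h\<close> y by (simp add: less_eq_blinfun_def)
      also have "0 \<le> blinfun_apply h (x - y)"
        using \<open>0 \<le> h\<close> y by (simp add: less_eq_blinfun_def)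
      then have "blinfun_apply h y \<le> blinfun_apply h x" by (simp add: blinfun.diff_right)
      finally show ?thesis .
    qed
    then show "blinfun_apply (blinfun_pprt k) x \<le> blinfun_apply h x"
      using x by (simp only: blinfun_pprt_pos) (rule sup_interval_least)
  qed
  have add_le: "k + f \<le> k + g \<longleftrightarrow> f \<le> g" for k f g :: "'a \<Rightarrow>\<^sub>L 'b"
    by (simp add: less_eq_blinfun_def blinfun.add_left)
  show "f \<le> g \<Longrightarrow> h + f \<le> h + g" by (simp add: add_le)
  show "f \<le> sup f g" "g \<le> sup f g"
    using pprt_upper[of "g - f"] add_le[of f 0] add_le[of f "g - f"]
    by (simp_all add: sup_blinfun_def)
  show "sup g h \<le> f" if "g \<le> f" "h \<le> f"
  proof -
    have "blinfun_pprt (h - g) \<le> f - g"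
      using that add_le[of g "h - g" "f - g"] add_le[of g 0 "f - g"] by (intro pprt_least) simp_all
    then show ?thesis using add_le[of g "blinfun_pprt (h - g)" "f - g"] by (simp add: sup_blinfun_def)
  qed
  have le_diff: "k \<le> f - l \<longleftrightarrow> l \<le> f - k" for k f l :: "'a \<Rightarrow>\<^sub>L 'b"
    by (simp add: less_eq_blinfun_def blinfun.diff_left le_diff_eq add.commute)
  have diff_le: "f - k \<le> l \<longleftrightarrow> f - l \<le> k" for k f l :: "'a \<Rightarrow>\<^sub>L 'b"
    by (simp add: less_eq_blinfun_def blinfun.diff_left diff_le_eq add.commute)
  show "inf f g \<le> f" "inf f g \<le> g"
    using pprt_upper[of "f - g"]
    by (simp_all add: inf_blinfun_def diff_le[of f _ f] diff_le[of f _ g])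
  show "f \<le> inf g h" if "f \<le> g" "f \<le> h"
  proof -
    have "blinfun_pprt (g - h) \<le> g - f"
      using that by (intro pprt_least) (simp_all add: le_diff[of 0] diff_le[of g h] )
    then show ?thesis by (simp add: inf_blinfun_def le_diff[of f])
  qed
  show "\<bar>f\<bar> = sup f (- f)" by (rule abs_blinfun_def)
  show "f \<le> g \<Longrightarrow> 0 \<le> r \<Longrightarrow> r *\<^sub>R f \<le> r *\<^sub>R g"
    by (simp add: less_eq_blinfun_def blinfun.scaleR_left scaleR_left_mono)
  show "r \<le> s \<Longrightarrow> 0 \<le> f \<Longrightarrow> r *\<^sub>R f \<le> s *\<^sub>R f"
    by (simp add: less_eq_blinfun_def blinfun.scaleR_left scaleR_right_mono)
  have le_abs: "k \<le> \<bar>k\<bar>" "- k \<le> \<bar>k\<bar>" for k :: "'a \<Rightarrow>\<^sub>L 'b"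
    using pprt_upper[of "- k - k"] add_le[of k 0] add_le[of k "- k - k"]
    by (simp_all add: abs_blinfun_def sup_blinfun_def)
  show "norm f \<le> norm g" if fg: "\<bar>f\<bar> \<le> \<bar>g\<bar>"
  proof (rule norm_blinfun_bound)
    fix x :: 'a
    obtain e :: 'b where "0 \<le> e" and e: "\<And>c y. 0 \<le> c \<Longrightarrow> norm y \<le> c \<longleftrightarrow> \<bar>y\<bar> \<le> c *\<^sub>R e"
      using order_unit_norm by blast
    let ?c = "norm g * norm x"
    have leD: "0 \<le> y \<Longrightarrow> blinfun_apply k y \<le> blinfun_apply l y" if "k \<le> l" for k l :: "'a \<Rightarrow>\<^sub>L 'b" and y
      using that by (simp add: less_eq_blinfun_def)
    have bound: "blinfun_apply \<bar>g\<bar> \<bar>x\<bar> \<le> ?c *\<^sub>R e"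
    proof -
      have "blinfun_apply (- g - g) y \<le> ?c *\<^sub>R e - blinfun_apply g \<bar>x\<bar>" if y: "y \<in> {0..\<bar>x\<bar>}" for y
      proof -
        have "\<bar>\<bar>x\<bar> - (y + y)\<bar> \<le> \<bar>x\<bar>"
        proof (rule abs_leI)
          show "\<bar>x\<bar> - (y + y) \<le> \<bar>x\<bar>" using y by (simp add: diff_le_eq)
          have "y + y \<le> \<bar>x\<bar> + \<bar>x\<bar>" using y by (intro add_mono) auto
          then show "- (\<bar>x\<bar> - (y + y)) \<le> \<bar>x\<bar>" by (simp add: diff_le_eq)
        qed
        then have "norm (\<bar>x\<bar> - (y + y)) \<le> norm x" by (rule norm_mono_abs)
        then have "norm (blinfun_apply g (\<bar>x\<bar> - (y + y))) \<le> ?c"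
          by (meson norm_blinfun norm_ge_zero mult_left_mono order_trans)
        moreover have "0 \<le> ?c" by simp
        ultimately have "\<bar>blinfun_apply g (\<bar>x\<bar> - (y + y))\<bar> \<le> ?c *\<^sub>R e"
          using e by blast
        from order_trans[OF abs_ge_self this]
        have "blinfun_apply g (\<bar>x\<bar> - (y + y)) \<le> ?c *\<^sub>R e" .
        then show ?thesis
          by (simp add: blinfun.add_right blinfun.diff_right blinfun.diff_left blinfun.minus_left
              algebra_simps)
      qed
      then have "blinfun_sup_interval (- g - g) \<bar>x\<bar> \<le> ?c *\<^sub>R e - blinfun_apply g \<bar>x\<bar>"
        by (intro sup_interval_least) simp_all
      then show ?thesis
        by (simp add: abs_blinfun_def sup_blinfun_def blinfun.add_left blinfun_pprt_pos algebra_simps)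
    qed
    have pos: "0 \<le> blinfun_apply \<bar>f\<bar> y" if y: "0 \<le> y" for y
    proof -
      have "blinfun_apply f y + blinfun_apply (- f) y \<le> blinfun_apply \<bar>f\<bar> y + blinfun_apply \<bar>f\<bar> y"
        using leD[OF le_abs(1) y] leD[OF le_abs(2) y] by (rule add_mono)
      then show ?thesis by (simp add: blinfun.minus_left)
    qed
    have key: "blinfun_apply f z \<le> blinfun_apply \<bar>f\<bar> \<bar>x\<bar>" if z: "\<bar>z\<bar> = \<bar>x\<bar>" for z
    proof -
      have "blinfun_apply f z = blinfun_apply f (pprt z) + blinfun_apply (- f) (pprt (- z))"
        using pprt_diff_eq[of z] by (metis blinfun.diff_right blinfun.minus_left diff_conv_add_uminus)
      also have "\<dots> \<le> blinfun_apply \<bar>f\<bar> (pprt z) + blinfun_apply \<bar>f\<bar> (pprt (- z))"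
        by (intro add_mono leD le_abs) simp_all
      also have "\<dots> = blinfun_apply \<bar>f\<bar> \<bar>z\<bar>"
        by (simp add: abs_prts pprt_neg blinfun.diff_right blinfun.minus_right)
      finally show ?thesis using z by simp
    qed
    have "\<bar>blinfun_apply f x\<bar> \<le> blinfun_apply \<bar>f\<bar> \<bar>x\<bar>"
      using key[of x] key[of "- x"] by (intro abs_leI) (simp_all add: blinfun.minus_right)
    also have "\<dots> \<le> blinfun_apply \<bar>g\<bar> \<bar>x\<bar>" using fg by (rule leD) simp
    also note bound
    finally show "norm (blinfun_apply f x) \<le> ?c" using e[of ?c] by simp
  qed simp
qed

end


subsection \<open>Disjointly weakly compact sets and Dunford-Pettis sets\<close>

definition weakly_null :: "(nat \<Rightarrow> 'a::real_normed_vector) \<Rightarrow> bool"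
  where "weakly_null x \<longleftrightarrow> (\<forall>f :: 'a \<Rightarrow>\<^sub>L real. (\<lambda>n. blinfun_apply f (x n)) \<longlonglongrightarrow> 0)"

definition solid_hull :: "'a::banach_lattice set \<Rightarrow> 'a set"
  where "solid_hull A = {y. \<exists>x\<in>A. \<bar>y\<bar> \<le> \<bar>x\<bar>}"

definition disjoint_seq :: "(nat \<Rightarrow> 'a::banach_lattice) \<Rightarrow> bool"
  where "disjoint_seq x \<longleftrightarrow> (\<forall>m n. m \<noteq> n \<longrightarrow> inf \<bar>x n\<bar> \<bar>x m\<bar> = 0)"

definition disjointly_weakly_compact :: "'a::banach_lattice set \<Rightarrow> bool"
  where "disjointly_weakly_compact A \<longleftrightarrow> bounded A \<and>
    (\<forall>x. disjoint_seq x \<and> range x \<subseteq> solid_hull A \<longrightarrow> weakly_null x)"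

text \<open>Suprema of absolute values are taken in \<^typ>\<open>ennreal\<close>, so that the supremum over the
  empty set is \<open>0\<close>; on \<^typ>\<open>real\<close> it would be unspecified.\<close>

definition dunford_pettis_set :: "'a::banach set \<Rightarrow> bool"
  where "dunford_pettis_set A \<longleftrightarrow> bounded A \<and>
    (\<forall>f :: nat \<Rightarrow> 'a \<Rightarrow>\<^sub>L real. weakly_null f \<longrightarrow>
      (\<lambda>n. SUP x\<in>A. ennreal \<bar>blinfun_apply (f n) x\<bar>) \<longlonglongrightarrow> 0)"

definition DW_DP_operator :: "('a::banach_lattice \<Rightarrow> 'b::banach) \<Rightarrow> bool"
  where "DW_DP_operator T \<longleftrightarrow> bounded_linear T \<and>
    (\<forall>A. disjointly_weakly_compact A \<longrightarrow> dunford_pettis_set (T ` A))"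

definition positive_operator :: "('a::banach_lattice \<Rightarrow> 'b::banach_lattice) \<Rightarrow> bool"
  where "positive_operator T \<longleftrightarrow> linear T \<and> (\<forall>x\<ge>0. 0 \<le> T x)"

end

theory Submission
  imports Defs
begin

text \<open>Both parts rest on one disjointification: for a bounded sequence of positive elements \<open>h n\<close>
  of a Banach lattice and \<open>e = (\<Sum>n. 2\<^sup>-\<^sup>n h n)\<close>, the elements
  \<open>(h n - 4\<^sup>n (\<Sum>i<n. h i) - 2\<^sup>-\<^sup>n e)\<^sup>+\<close> are pairwise disjoint. If (1) fails,
  weak nullity of the given sequence lets one choose functionals \<open>h n\<close> in the solid hull of \<open>V\<close>
  and points \<open>y n\<close> at which \<open>4\<^sup>n (\<Sum>i<n. h i)\<close> is negligible; the disjointified functionals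
  are weakly null but do not tend to zero uniformly on the Dunford-Pettis set \<open>T (Sol W)\<close>.
  If (2) fails, the failure for \<open>u = 4\<^sup>n (\<Sum>i<n. h i)\<close> yields \<open>h n = |x|\<close> with \<open>x \<in> W\<close>, and the
  disjointified elements contradict (1).\<close>

section \<open>Norm and positive cone of a Banach lattice\<close>

lemma norm_abs_banach_lattice: "norm \<bar>x\<bar> = norm (x::'a::banach_lattice)"
  by (intro order.antisym norm_mono_abs) simp_all

lemma norm_mono_nonneg: "0 \<le> x \<Longrightarrow> x \<le> y \<Longrightarrow> norm x \<le> norm (y::'a::banach_lattice)"
  by (rule norm_mono_abs) (use order_trans[of 0 x y] in simp)

lemma le_pprt: "x \<le> pprt (x::'a::lattice_ab_group_add)"
  by (simp add: pprt_def)

lemma pprt_least: "x \<le> y \<Longrightarrow> 0 \<le> y \<Longrightarrow> pprt x \<le> (y::'a::lattice_ab_group_add)"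
  by (simp add: pprt_def)

text \<open>Since \<open>- z <= s n - z\<close>, the negative part of \<open>z\<close> lies below
  \<open>\<bar>s n - z\<bar>\<close>, whose norm tends to zero; hence it vanishes.\<close>

lemma nonneg_limit:
  fixes z :: "'a::banach_lattice"
  assumes lim: "s \<longlonglongrightarrow> z" and nonneg: "\<And>n. 0 \<le> s n"
  shows "0 \<le> z"
proof -
  have "norm (pprt (- z)) \<le> norm (s n - z)" for n
  proof -
    have "- z \<le> s n - z" using nonneg[of n] by (simp add: algebra_simps)
    then have "pprt (- z) \<le> \<bar>s n - z\<bar>"
      by (intro pprt_least abs_ge_zero) (rule order_trans[OF _ abs_ge_self])
    then show ?thesis
      by (metis norm_abs_banach_lattice norm_mono_nonneg zero_le_pprt)
  qed
  moreover have "(\<lambda>n. norm (s n - z)) \<longlonglongrightarrow> 0"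
    using lim by (simp add: LIM_zero_iff tendsto_norm_zero_iff)
  ultimately have "norm (pprt (- z)) \<le> 0"
    by (intro LIMSEQ_le_const) auto
  then have "pprt (- z) = 0" by simp
  then have "- z \<le> 0" using le_pprt[of "- z"] by simp
  then show ?thesis by simp
qed

lemma le_suminf:
  fixes f :: "nat \<Rightarrow> 'a::banach_lattice"
  assumes "summable f" and nonneg: "\<And>n. 0 \<le> f n"
  shows "f n \<le> suminf f"
proof -
  \<comment> \<open>Starting at \<open>m + Suc n\<close> makes every partial sum contain the index
    \<open>n\<close>, so subtracting \<open>f n\<close> leaves a sum of positive terms.\<close>
  have "(\<lambda>m. sum f {..<m + Suc n}) \<longlonglongrightarrow> suminf f"
    using summable_LIMSEQ[OF assms(1)] by (rule LIMSEQ_ignore_initial_segment)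
  then have "(\<lambda>m. sum f {..<m + Suc n} - f n) \<longlonglongrightarrow> suminf f - f n"
    by (intro tendsto_intros)
  moreover have "0 \<le> sum f {..<m + Suc n} - f n" for m
    using sum_mono2[of "{..<m + Suc n}" "{n}" f] nonneg by simp
  ultimately have "0 \<le> suminf f - f n" by (rule nonneg_limit)
  then show ?thesis by simp
qed

section \<open>Disjointification of positive sequences\<close>

text \<open>Dividing the infimum by \<open>c\<close> puts it below both the positive and the
  negative part of \<open>y\<close>, and these are disjoint. The bound by \<open>pprt y\<close>
  survives the division because \<open>c >= 1\<close>.\<close>

lemma inf_pprt_scaleR_pprt_uminus:
  fixes y :: "'a::banach_lattice"
  assumes c: "1 \<le> c"
  shows "inf (pprt y) (c *\<^sub>R pprt (- y)) = 0"
proof (rule order.antisym)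
  let ?z = "inf (pprt y) (c *\<^sub>R pprt (- y))"
  have z0: "0 \<le> ?z" using c by (simp add: scaleR_nonneg_nonneg)
  have "(1/c) *\<^sub>R ?z \<le> 1 *\<^sub>R ?z"
    using c z0 by (intro scaleR_right_mono) auto
  then have 1: "(1/c) *\<^sub>R ?z \<le> pprt y"
    using inf_le1 order_trans by fastforce
  have "(1/c) *\<^sub>R ?z \<le> (1/c) *\<^sub>R (c *\<^sub>R pprt (- y))"
    using c by (intro scaleR_left_mono) auto
  then have 2: "(1/c) *\<^sub>R ?z \<le> pprt (- y)" using c by simp
  have "inf (pprt y) (pprt (- y)) = 0"
  proof -
    \<comment> \<open>In general \<open>a - inf a b = sup 0 (a - b)\<close>; for the two parts of
      \<open>y\<close> the difference \<open>a - b\<close> is \<open>y\<close> itself.\<close>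
    have "pprt y - inf (pprt y) (pprt (- y)) = sup 0 (pprt y - pprt (- y))"
      by (metis add_sup_distrib_left diff_inf_eq_sup add.right_inverse diff_conv_add_uminus)
    also have "\<dots> = pprt y" by (simp only: pprt_diff_eq) (simp add: pprt_def sup_commute)
    finally have "pprt y - inf (pprt y) (pprt (- y)) = pprt y" .
    then show ?thesis by (metis add_diff_cancel_left' diff_add_cancel diff_self)
  qed
  then have "(1/c) *\<^sub>R ?z \<le> 0" using 1 2 by (metis le_inf_iff)
  from scaleR_left_mono[OF this, of c] show "?z \<le> 0" using c by simp
  show "0 \<le> ?z" by (rule z0)
qed

text \<open>For \<open>m < n\<close> the single element \<open>y = h m - (1/2^(m+n)) h n\<close>
  separates the two terms. The term at \<open>m\<close> lies below the positive part of
  \<open>y\<close>, because \<open>(1/2^m) e\<close> dominates \<open>(1/2^(m+n)) h n\<close>. The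
  term at \<open>n\<close> lies below \<open>2^(m+n)\<close> times the negative part of
  \<open>y\<close>, because the subtracted sum contains \<open>h m\<close>.\<close>

lemma disjoint_seq_pprt:
  fixes h :: "nat \<Rightarrow> 'a::banach_lattice"
  assumes nonneg: "\<And>n. 0 \<le> h n" and e: "\<And>n. (1/2^n) *\<^sub>R h n \<le> e"
  shows "disjoint_seq (\<lambda>n. pprt (h n - 4^n *\<^sub>R (\<Sum>i<n. h i) - (1/2^n) *\<^sub>R e))"
    (is "disjoint_seq ?w")
proof -
  have e0: "0 \<le> e" using e[of 0] nonneg[of 0] by simp
  have disj: "inf (?w m) (?w n) = 0" if "m < n" for m n
  proof -
    let ?c = "2^(m + n) :: real"
    let ?y = "h m - (1/?c) *\<^sub>R h n"
    have "?w m \<le> pprt ?y"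
    proof (rule pprt_mono)
      have "(1/2^m) *\<^sub>R ((1/2^n) *\<^sub>R h n) \<le> (1/2^m) *\<^sub>R e"
        by (intro scaleR_left_mono e) simp
      moreover have "0 \<le> 4^m *\<^sub>R (\<Sum>i<m. h i)"
        by (intro scaleR_nonneg_nonneg sum_nonneg nonneg) simp
      ultimately have "(1/?c) *\<^sub>R h n \<le> 4^m *\<^sub>R (\<Sum>i<m. h i) + (1/2^m) *\<^sub>R e"
        using add_mono by (fastforce simp: power_add)
      then show "h m - 4^m *\<^sub>R (\<Sum>i<m. h i) - (1/2^m) *\<^sub>R e \<le> ?y"
        by (simp add: diff_diff_eq diff_left_mono)
    qed
    moreover have "?w n \<le> ?c *\<^sub>R pprt (- ?y)"
    proof (rule pprt_least)
      \<comment> \<open>The factor \<open>4^n\<close> is chosen so that it dominates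
        \<open>2^(m+n)\<close> for all \<open>m < n\<close> at once.\<close>
      have "?c \<le> 2^(n + n)" using that by (intro power_increasing) auto
      then have c4: "?c \<le> 4^n" by (simp add: power_add power_mult_distrib[symmetric])
      have "?c *\<^sub>R h m \<le> 4^n *\<^sub>R h m"
        by (intro scaleR_right_mono c4 nonneg)
      also have "\<dots> \<le> 4^n *\<^sub>R (\<Sum>i<n. h i)"
        using sum_mono2[of "{..<n}" "{m}" h] that nonneg by (intro scaleR_left_mono) auto
      finally have "?c *\<^sub>R h m \<le> 4^n *\<^sub>R (\<Sum>i<n. h i)" .
      moreover have "0 \<le> (1/2^n) *\<^sub>R e" using e0 by (intro scaleR_nonneg_nonneg) auto
      ultimately have "?c *\<^sub>R h m \<le> 4^n *\<^sub>R (\<Sum>i<n. h i) + (1/2^n) *\<^sub>R e"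
        using add_mono by fastforce
      then have "h n - 4^n *\<^sub>R (\<Sum>i<n. h i) - (1/2^n) *\<^sub>R e \<le> h n - ?c *\<^sub>R h m"
        by (simp add: diff_diff_eq diff_left_mono)
      also have "\<dots> = ?c *\<^sub>R (- ?y)" by (simp add: scaleR_diff_right)
      also have "\<dots> \<le> ?c *\<^sub>R pprt (- ?y)"
        by (intro scaleR_left_mono le_pprt) simp
      finally show "h n - 4^n *\<^sub>R (\<Sum>i<n. h i) - (1/2^n) *\<^sub>R e \<le> ?c *\<^sub>R pprt (- ?y)" .
      show "0 \<le> ?c *\<^sub>R pprt (- ?y)" by (intro scaleR_nonneg_nonneg) auto
    qed
    ultimately have "inf (?w m) (?w n) \<le> inf (pprt ?y) (?c *\<^sub>R pprt (- ?y))"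
      by (rule inf_mono)
    also have "\<dots> = 0" by (rule inf_pprt_scaleR_pprt_uminus) simp
    finally show ?thesis by (intro order.antisym) simp_all
  qed
  show ?thesis unfolding disjoint_seq_def
  proof (intro allI impI)
    fix m n :: nat assume "m \<noteq> n"
    then have "inf (?w n) (?w m) = 0"
      using disj[of m n] disj[of n m] by (metis inf.commute linorder_neqE_nat)
    then show "inf \<bar>?w n\<bar> \<bar>?w m\<bar> = 0" by (simp only: abs_of_nonneg zero_le_pprt)
  qed
qed

text \<open>Leaving \<open>P u a\<close> abstract lets one construction serve both functionals and
  lattice elements: it expresses that \<open>a\<close> is bad relative to the bound
  \<open>u\<close>. The last conclusion controls how much of \<open>h n\<close> is lost in passing
  to the disjoint term \<open>w n\<close>.\<close>

lemma disjointification: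
  fixes A :: "'a::banach_lattice set"
  assumes bdd: "bounded A"
    and ex: "\<And>u. 0 \<le> u \<Longrightarrow> \<exists>a\<in>A. 0 \<le> a \<and> P u a"
  obtains h w e where "\<And>n. h n \<in> A" "\<And>n. P (4^n *\<^sub>R (\<Sum>i<n. h i)) (h n)"
    "disjoint_seq w" "\<And>n. 0 \<le> w n" "\<And>n. w n \<le> h n" "0 \<le> e"
    "\<And>n. h n - 4^n *\<^sub>R (\<Sum>i<n. h i) - (1/2^n) *\<^sub>R e \<le> w n"
proof -
  from ex obtain \<phi> where \<phi>: "\<And>u. 0 \<le> u \<Longrightarrow> \<phi> u \<in> A \<and> 0 \<le> \<phi> u \<and> P u (\<phi> u)" by metis
  \<comment> \<open>The recursion carries the running sum of the chosen elements, which is all that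
    the next choice depends on.\<close>
  define s where "s = rec_nat 0 (\<lambda>n t. t + \<phi> (4^n *\<^sub>R t))"
  define h where "h n = \<phi> (4^n *\<^sub>R s n)" for n
  have s_Suc: "s (Suc n) = s n + h n" for n by (simp add: s_def h_def)
  have s_sum: "s n = (\<Sum>i<n. h i)" for n
    by (induction n) (simp_all add: s_Suc, simp add: s_def)
  have "0 \<le> s n" for n
    by (induction n) (simp add: s_def, simp add: s_Suc h_def \<phi> scaleR_nonneg_nonneg)
  then have h: "h n \<in> A \<and> 0 \<le> h n \<and> P (4^n *\<^sub>R (\<Sum>i<n. h i)) (h n)" for n
    unfolding s_sum[symmetric] by (simp only: h_def) (intro \<phi> scaleR_nonneg_nonneg, simp_all)
  let ?g = "\<lambda>n. (1/2^n) *\<^sub>R h n"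
  obtain C where C: "\<And>a. a \<in> A \<Longrightarrow> norm a \<le> C" using bdd by (auto simp: bounded_iff)
  \<comment> \<open>Boundedness of \<open>A\<close> gives a geometric majorant, so the series
    defining \<open>e\<close> converges by completeness.\<close>
  have "summable ?g"
  proof (rule summable_comparison_test')
    show "summable (\<lambda>n. C * (1/2)^n)" by (intro summable_mult summable_geometric) simp
    show "norm (?g n) \<le> C * (1/2)^n" if "n \<ge> 0" for n
      using C[of "h n"] h[of n] by (simp add: power_divide divide_right_mono)
  qed
  then have e: "?g n \<le> suminf ?g" for n
    using h by (intro le_suminf scaleR_nonneg_nonneg) auto
  have e0: "0 \<le> suminf ?g" using e[of 0] h[of 0] by auto
  have "pprt (h n - 4^n *\<^sub>R (\<Sum>i<n. h i) - (1/2^n) *\<^sub>R suminf ?g) \<le> h n" for n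
  proof (rule pprt_least)
    have "0 \<le> 4^n *\<^sub>R (\<Sum>i<n. h i) + (1/2^n) *\<^sub>R suminf ?g"
      using h e0 by (intro add_nonneg_nonneg scaleR_nonneg_nonneg sum_nonneg) auto
    then show "h n - 4^n *\<^sub>R (\<Sum>i<n. h i) - (1/2^n) *\<^sub>R suminf ?g \<le> h n"
      by (simp only: diff_diff_eq diff_le_eq le_add_same_cancel1)
  qed (simp add: h)
  moreover have "disjoint_seq (\<lambda>n. pprt (h n - 4^n *\<^sub>R (\<Sum>i<n. h i) - (1/2^n) *\<^sub>R suminf ?g))"
    using h e by (intro disjoint_seq_pprt) auto
  ultimately show thesis
    using h e0 le_pprt zero_le_pprt
    by (intro that[where w = "\<lambda>n. pprt (h n - 4^n *\<^sub>R (\<Sum>i<n. h i) - (1/2^n) *\<^sub>R suminf ?g)"]) auto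
qed

section \<open>Order of functionals, solid hulls and positive operators\<close>

lemma blinfun_le_apply: "f \<le> g \<Longrightarrow> 0 \<le> x \<Longrightarrow> blinfun_apply f x \<le> blinfun_apply g x"
  for f g :: "'a::banach_lattice \<Rightarrow>\<^sub>L 'b::complete_unit_banach_lattice"
  by (simp add: less_eq_blinfun_def)

lemma blinfun_mono_apply: "0 \<le> f \<Longrightarrow> x \<le> y \<Longrightarrow> blinfun_apply f x \<le> blinfun_apply f y"
  for f :: "'a::banach_lattice \<Rightarrow>\<^sub>L 'b::complete_unit_banach_lattice"
  using blinfun_le_apply[of 0 f "y - x"] by (simp add: blinfun.diff_right)

text \<open>Write \<open>f z\<close> as \<open>f\<close> at the positive part of \<open>z\<close>
  plus \<open>- f\<close> at its negative part; both \<open>f\<close> and \<open>- f\<close> lie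
  below \<open>\<bar>f\<bar>\<close>. Using this for \<open>x\<close> and \<open>- x\<close> gives
  the two-sided bound.\<close>

lemma abs_blinfun_apply_le: "\<bar>blinfun_apply f x\<bar> \<le> blinfun_apply \<bar>f\<bar> \<bar>x\<bar>"
  for f :: "'a::banach_lattice \<Rightarrow>\<^sub>L 'b::complete_unit_banach_lattice"
proof -
  have key: "blinfun_apply f z \<le> blinfun_apply \<bar>f\<bar> \<bar>z\<bar>" for z
  proof -
    have "blinfun_apply f z = blinfun_apply f (pprt z) + blinfun_apply (- f) (pprt (- z))"
      using pprt_diff_eq[of z] by (metis blinfun.diff_right blinfun.minus_left diff_conv_add_uminus)
    also have "\<dots> \<le> blinfun_apply \<bar>f\<bar> (pprt z) + blinfun_apply \<bar>f\<bar> (pprt (- z))"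
      by (intro add_mono blinfun_le_apply abs_ge_self abs_ge_minus_self) simp_all
    also have "\<dots> = blinfun_apply \<bar>f\<bar> \<bar>z\<bar>"
      by (simp add: abs_prts pprt_neg blinfun.diff_right blinfun.minus_right)
    finally show ?thesis .
  qed
  from key[of x] key[of "- x"] show ?thesis
    by (intro abs_leI) (simp_all add: blinfun.minus_right)
qed

lemma solid_hull_idem: "solid_hull (solid_hull A) = solid_hull A"
  unfolding solid_hull_def by (auto intro: order_trans)

lemma subset_solid_hull: "A \<subseteq> solid_hull A"
  unfolding solid_hull_def by auto

lemma solid_hull_abs_le: "x \<in> solid_hull A \<Longrightarrow> \<bar>y\<bar> \<le> \<bar>x\<bar> \<Longrightarrow> y \<in> solid_hull A"
  unfolding solid_hull_def by (auto intro: order_trans)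

lemma abs_in_solid_hull: "x \<in> solid_hull A \<Longrightarrow> \<bar>x\<bar> \<in> solid_hull A"
  by (erule solid_hull_abs_le) simp

lemma solid_hull_nonneg_le: "x \<in> solid_hull A \<Longrightarrow> 0 \<le> y \<Longrightarrow> y \<le> x \<Longrightarrow> y \<in> solid_hull A"
  by (erule solid_hull_abs_le) (use order_trans[of 0 y x] in simp)

lemma bounded_solid_hull: "bounded A \<Longrightarrow> bounded (solid_hull A)"
  unfolding bounded_iff solid_hull_def by (blast intro: norm_mono_abs order_trans)

text \<open>The condition on disjoint sequences sees only the solid hull, which is idempotent. This
  allows the Dunford-Pettis property to be used on \<open>T\<close> of a whole solid hull.\<close>

lemma disjointly_weakly_compact_solid_hull:
  "disjointly_weakly_compact A \<Longrightarrow> disjointly_weakly_compact (solid_hull A)"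
  unfolding disjointly_weakly_compact_def by (simp add: solid_hull_idem bounded_solid_hull)

lemma positive_operator_mono: "positive_operator T \<Longrightarrow> x \<le> y \<Longrightarrow> T x \<le> T y"
  unfolding positive_operator_def by (metis diff_ge_0_iff_ge linear_diff)

lemma positive_operator_abs: "positive_operator T \<Longrightarrow> \<bar>T x\<bar> \<le> T \<bar>x\<bar>"
  using positive_operator_mono[of T x "\<bar>x\<bar>"] positive_operator_mono[of T "- x" "\<bar>x\<bar>"]
  by (intro abs_leI) (auto simp: positive_operator_def linear_neg abs_ge_self abs_ge_minus_self)

section \<open>Translation between suprema in \<open>ennreal\<close> and real bounds\<close>

lemma SUP_ennreal_tendsto_0D:
  assumes "(\<lambda>n. SUP x\<in>A. ennreal (g n x)) \<longlonglongrightarrow> 0" "0 < \<epsilon>"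
  shows "\<forall>\<^sub>F n in sequentially. \<forall>x\<in>A. g n x < (\<epsilon>::real)"
proof -
  have "\<forall>\<^sub>F n in sequentially. (SUP x\<in>A. ennreal (g n x)) < ennreal \<epsilon>"
    using assms by (intro order_tendstoD) auto
  then show ?thesis
  proof eventually_elim
    case (elim n)
    show ?case
    proof
      fix x assume "x \<in> A"
      then have "ennreal (g n x) < ennreal \<epsilon>"
        using elim by (meson SUP_upper le_less_trans)
      then show "g n x < \<epsilon>" using assms(2) by (meson ennreal_leI not_le)
    qed
  qed
qed

text \<open>Failure of convergence gives a level \<open>c\<close> that the suprema reach infinitely
  often; a strictly smaller level is then exceeded by an actual member.\<close>

lemma not_SUP_ennreal_tendsto_0D:
  assumes "\<not> (\<lambda>n. SUP x\<in>A. ennreal (g n x)) \<longlonglongrightarrow> 0"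
  obtains \<epsilon> :: real where "0 < \<epsilon>" "\<And>N. \<exists>n\<ge>N. \<exists>x\<in>A. \<epsilon> < g n x"
proof -
  obtain c :: ennreal where "0 < c"
      and c: "\<not> (\<forall>\<^sub>F n in sequentially. (SUP x\<in>A. ennreal (g n x)) < c)"
    using assms order_tendstoI[of 0 "\<lambda>n. SUP x\<in>A. ennreal (g n x)" sequentially] by fastforce
  \<comment> \<open>A level strictly between \<open>0\<close> and \<open>c\<close> is finite even
    when \<open>c\<close> is infinite, so it comes from a real number.\<close>
  from dense[OF \<open>0 < c\<close>] obtain b where b: "0 < b" "b < c" by blast
  then obtain \<epsilon> where \<epsilon>: "b = ennreal \<epsilon>" "0 < \<epsilon>"
    by (cases b) (auto simp: less_top[symmetric])
  show thesis
  proof (rule that[OF \<epsilon>(2)])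
    fix N
    from c obtain n where n: "n \<ge> N" "c \<le> (SUP x\<in>A. ennreal (g n x))"
      unfolding eventually_sequentially by (meson not_le)
    then have "ennreal \<epsilon> < (SUP x\<in>A. ennreal (g n x))"
      using b \<epsilon>(1) by simp
    then obtain x where "x \<in> A" "ennreal \<epsilon> < ennreal (g n x)"
      by (auto simp: less_SUP_iff)
    then show "\<exists>n\<ge>N. \<exists>x\<in>A. \<epsilon> < g n x"
      using n(1) \<epsilon>(2) by (auto simp: ennreal_less_iff)
  qed
qed

section \<open>Uniform convergence along disjoint sequences\<close>

lemma DW_DP_disjoint_seq_uniform:
  fixes T :: "'a::banach_lattice \<Rightarrow> 'b::banach_lattice"
  assumes pos: "positive_operator T" and DW: "DW_DP_operator T"
    and W: "disjointly_weakly_compact W" and V: "disjointly_weakly_compact V"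
    and x: "disjoint_seq x" "range x \<subseteq> solid_hull W"
  shows "(\<lambda>n. SUP f\<in>solid_hull V. ennreal \<bar>blinfun_apply f (T (x n))\<bar>) \<longlonglongrightarrow> 0"
proof (rule ccontr)
  let ?a = "\<lambda>n. SUP f\<in>solid_hull V. ennreal \<bar>blinfun_apply f (T (x n))\<bar>"
  assume "\<not> ?a \<longlonglongrightarrow> 0"
  then obtain \<epsilon> where \<epsilon>: "0 < \<epsilon>"
    and freq: "\<And>N. \<exists>n\<ge>N. \<exists>f\<in>solid_hull V. \<epsilon> < \<bar>blinfun_apply f (T (x n))\<bar>"
    by (rule not_SUP_ennreal_tendsto_0D) (rule that)
  have T: "bounded_linear T" using DW by (simp add: DW_DP_operator_def)
  \<comment> \<open>As a bounded operator, \<open>T\<close> can be composed with a functional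
    \<open>g\<close>, so that weak nullity in the domain can be tested on \<open>g\<close> after
    \<open>T\<close>.\<close>
  define S where "S = Blinfun T"
  have S: "blinfun_apply S = T" by (simp add: S_def T bounded_linear_Blinfun_apply)
  have "weakly_null (\<lambda>n. \<bar>x n\<bar>)"
  proof -
    have "disjoint_seq (\<lambda>n. \<bar>x n\<bar>)"
      using x(1) unfolding disjoint_seq_def abs_idempotent .
    moreover have "range (\<lambda>n. \<bar>x n\<bar>) \<subseteq> solid_hull W"
      using x(2) by (auto intro: abs_in_solid_hull)
    ultimately show ?thesis using W by (simp add: disjointly_weakly_compact_def)
  qed
  then have "(\<lambda>n. blinfun_apply (g o\<^sub>L S) \<bar>x n\<bar>) \<longlonglongrightarrow> 0" for g :: "'b \<Rightarrow>\<^sub>L real"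
    unfolding weakly_null_def by blast
  then have null: "(\<lambda>n. blinfun_apply g (T \<bar>x n\<bar>)) \<longlonglongrightarrow> 0" for g :: "'b \<Rightarrow>\<^sub>L real"
    by (simp add: S)
  \<comment> \<open>Here \<open>g\<close> will be the weighted sum of the functionals already chosen
    and \<open>f\<close> the next one; \<open>y\<close> is a point where \<open>f\<close> is large
    while \<open>g\<close> is small.\<close>
  let ?P = "\<lambda>g f. \<exists>y\<in>solid_hull W. 0 \<le> y \<and> \<epsilon> < blinfun_apply f (T y) \<and> blinfun_apply g (T y) < \<epsilon>/2"
  have ex: "\<exists>f\<in>solid_hull V. 0 \<le> f \<and> ?P g f" if "0 \<le> g" for g
  proof -
    \<comment> \<open>For fixed \<open>g\<close> the values at \<open>T \<bar>x n\<bar>\<close> are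
      eventually small, while values above \<open>\<epsilon>\<close> recur at arbitrarily late
      indices; a late bad index meets both demands.\<close>
    obtain N where N: "\<And>n. n \<ge> N \<Longrightarrow> blinfun_apply g (T \<bar>x n\<bar>) < \<epsilon>/2"
      using order_tendstoD(2)[OF null, of "\<epsilon>/2" g] \<epsilon> by (auto simp: eventually_sequentially)
    obtain n f where n: "n \<ge> N" and f: "f \<in> solid_hull V" "\<epsilon> < \<bar>blinfun_apply f (T (x n))\<bar>"
      using freq by blast
    have "\<epsilon> < blinfun_apply \<bar>f\<bar> \<bar>T (x n)\<bar>"
      using f(2) abs_blinfun_apply_le by (rule less_le_trans)
    also have "\<dots> \<le> blinfun_apply \<bar>f\<bar> (T \<bar>x n\<bar>)"
      by (intro blinfun_mono_apply positive_operator_abs pos) simp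
    finally have "?P g \<bar>f\<bar>"
      using N[OF n] x(2) by (intro bexI[of _ "\<bar>x n\<bar>"]) (auto intro: abs_in_solid_hull)
    then show ?thesis
      using f(1) by (intro bexI[of _ "\<bar>f\<bar>"]) (auto intro: abs_in_solid_hull)
  qed
  have "bounded (solid_hull V)"
    using V by (simp add: disjointly_weakly_compact_def bounded_solid_hull)
  then obtain h w e where h: "\<And>n. h n \<in> solid_hull V"
      "\<And>n. ?P (4^n *\<^sub>R (\<Sum>i<n. h i)) (h n)"
    and w: "disjoint_seq w" "\<And>n. 0 \<le> w n" "\<And>n. w n \<le> h n" and "0 \<le> e"
    and le_w: "\<And>n. h n - 4^n *\<^sub>R (\<Sum>i<n. h i) - (1/2^n) *\<^sub>R e \<le> w n"
    by (rule disjointification[of "solid_hull V" ?P]) (erule ex, rule that)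
  from h(2) obtain y where y: "\<And>n. y n \<in> solid_hull W" "\<And>n. 0 \<le> y n"
      "\<And>n. \<epsilon> < blinfun_apply (h n) (T (y n))"
      "\<And>n. blinfun_apply (4^n *\<^sub>R (\<Sum>i<n. h i)) (T (y n)) < \<epsilon>/2"
    by metis
  have Ty: "0 \<le> T (y n)" for n using pos y(2) by (simp add: positive_operator_def)
  have "w n \<in> solid_hull V" for n
    using h(1) w(2,3) by (rule solid_hull_nonneg_le)
  then have wnull: "weakly_null w"
    using V w(1) by (auto simp: disjointly_weakly_compact_def)
  have "dunford_pettis_set (T ` solid_hull W)"
    using DW W disjointly_weakly_compact_solid_hull by (auto simp: DW_DP_operator_def)
  then have "(\<lambda>n. SUP z\<in>T ` solid_hull W. ennreal \<bar>blinfun_apply (w n) z\<bar>) \<longlonglongrightarrow> 0"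
    using wnull by (simp add: dunford_pettis_set_def)
  from SUP_ennreal_tendsto_0D[OF this, of "\<epsilon>/4"] \<epsilon>
  have ev1: "\<forall>\<^sub>F n in sequentially. \<forall>z\<in>T ` solid_hull W. \<bar>blinfun_apply (w n) z\<bar> < \<epsilon>/4"
    by simp
  have "bounded (T ` solid_hull W)"
    using \<open>dunford_pettis_set _\<close> by (simp add: dunford_pettis_set_def)
  then obtain C where C: "\<And>z. z \<in> T ` solid_hull W \<Longrightarrow> norm z \<le> C"
    by (auto simp: bounded_iff)
  \<comment> \<open>This bounds the correction \<open>(1/2^n) e\<close> uniformly on
    \<open>T\<close> of the solid hull.\<close>
  have "(\<lambda>n. (1/2^n) * (norm e * C)) \<longlonglongrightarrow> 0"
    by (intro tendsto_mult_left_zero) (simp add: LIMSEQ_divide_realpow_zero)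
  then have ev2: "\<forall>\<^sub>F n in sequentially. (1/2^n) * (norm e * C) < \<epsilon>/4"
    using \<epsilon> by (intro order_tendstoD) auto
  from ev1 ev2 have "\<forall>\<^sub>F n in sequentially. False"
  proof eventually_elim
    case (elim n)
    have "blinfun_apply e (T (y n)) \<le> norm e * C"
      using norm_blinfun[of e "T (y n)"] mult_left_mono[OF C, of "T (y n)" "norm e"] y(1)[of n]
      by (simp add: abs_le_iff)
    then have "(1/2^n) * blinfun_apply e (T (y n)) \<le> (1/2^n) * (norm e * C)"
      by (intro mult_left_mono) auto
    moreover have "blinfun_apply (h n - 4^n *\<^sub>R (\<Sum>i<n. h i) - (1/2^n) *\<^sub>R e) (T (y n))
        \<le> blinfun_apply (w n) (T (y n))"
      by (intro blinfun_le_apply le_w Ty)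
    \<comment> \<open>The two losses are the earlier functionals, below \<open>\<epsilon>/2\<close>,
      and the correction term, below \<open>\<epsilon>/4\<close>. The remaining
      \<open>\<epsilon>/4\<close> contradicts the uniform smallness of \<open>w n\<close>.\<close>
    ultimately have "\<epsilon> - \<epsilon>/2 - \<epsilon>/4 < blinfun_apply (w n) (T (y n))"
      using y(3)[of n] y(4)[of n] elim(2)
      unfolding blinfun.diff_left blinfun.scaleR_left[of "1/2^n"] real_scaleR_def by linarith
    moreover have "\<bar>blinfun_apply (w n) (T (y n))\<bar> < \<epsilon>/4" using elim(1) y(1) by blast
    ultimately show False by simp
  qed
  then show False by simp
qed

section \<open>Approximate order bounds\<close>

lemma DW_DP_almost_order_bounded:
  fixes T :: "'a::banach_lattice \<Rightarrow> 'b::banach_lattice"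
    and V :: "('b \<Rightarrow>\<^sub>L real) set"
  assumes pos: "positive_operator T" and DW: "DW_DP_operator T"
    and W: "disjointly_weakly_compact W" and V: "disjointly_weakly_compact V"
    and \<epsilon>: "0 < \<epsilon>"
  shows "\<exists>u\<ge>0. \<forall>x\<in>W. \<forall>f\<in>V. blinfun_apply \<bar>f\<bar> (T (pprt (\<bar>x\<bar> - u))) < \<epsilon>"
proof (rule ccontr)
  let ?P = "\<lambda>u a. \<exists>f\<in>V. \<epsilon> \<le> blinfun_apply \<bar>f\<bar> (T (pprt (a - u)))"
  assume "\<not> ?thesis"
  then have "\<exists>x\<in>W. ?P u \<bar>x\<bar>" if "0 \<le> u" for u using that by (auto simp: not_less)
  \<comment> \<open>\<open>W\<close> itself need not contain absolute values, so the elements are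
    chosen from its solid hull.\<close>
  moreover have "\<bar>x\<bar> \<in> solid_hull W" if "x \<in> W" for x
    using that subset_solid_hull by (blast intro: abs_in_solid_hull)
  ultimately have ex: "\<exists>a\<in>solid_hull W. 0 \<le> a \<and> ?P u a" if "0 \<le> u" for u
    using that abs_ge_zero by meson
  have "bounded (solid_hull W)"
    using W by (simp add: disjointly_weakly_compact_def bounded_solid_hull)
  then obtain h w e where h: "\<And>n. h n \<in> solid_hull W"
      "\<And>n. ?P (4^n *\<^sub>R (\<Sum>i<n. h i)) (h n)"
    and w: "disjoint_seq w" "\<And>n. 0 \<le> w n" "\<And>n. w n \<le> h n" and "0 \<le> e"
    and le_w: "\<And>n. h n - 4^n *\<^sub>R (\<Sum>i<n. h i) - (1/2^n) *\<^sub>R e \<le> w n"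
    by (rule disjointification[of "solid_hull W" ?P]) (erule ex, rule that)
  from h(2) obtain f where f: "\<And>n. f n \<in> V"
      "\<And>n. \<epsilon> \<le> blinfun_apply \<bar>f n\<bar> (T (pprt (h n - 4^n *\<^sub>R (\<Sum>i<n. h i))))"
    by metis
  have "w n \<in> solid_hull W" for n
    using h(1) w(2,3) by (rule solid_hull_nonneg_le)
  then have "(\<lambda>n. SUP f\<in>solid_hull V. ennreal \<bar>blinfun_apply f (T (w n))\<bar>) \<longlonglongrightarrow> 0"
    using DW_DP_disjoint_seq_uniform[OF pos DW W V w(1)] by blast
  from SUP_ennreal_tendsto_0D[OF this, of "\<epsilon>/2"] \<epsilon>
  have ev1: "\<forall>\<^sub>F n in sequentially. \<forall>f\<in>solid_hull V. \<bar>blinfun_apply f (T (w n))\<bar> < \<epsilon>/2"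
    by simp
  obtain C where C: "\<And>f. f \<in> V \<Longrightarrow> norm f \<le> C"
    using V by (auto simp: disjointly_weakly_compact_def bounded_iff)
  have "(\<lambda>n. (1/2^n) * (C * norm (T e))) \<longlonglongrightarrow> 0"
    by (intro tendsto_mult_left_zero) (simp add: LIMSEQ_divide_realpow_zero)
  then have ev2: "\<forall>\<^sub>F n in sequentially. (1/2^n) * (C * norm (T e)) < \<epsilon>/2"
    using \<epsilon> by (intro order_tendstoD) auto
  have lin: "linear T" using pos by (simp add: positive_operator_def)
  from ev1 ev2 have "\<forall>\<^sub>F n in sequentially. False"
  proof eventually_elim
    case (elim n)
    have "blinfun_apply \<bar>f n\<bar> (T e) \<le> C * norm (T e)"
      using norm_blinfun[of "\<bar>f n\<bar>" "T e"] mult_right_mono[OF C[OF f(1)[of n]], of "norm (T e)"]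
      by (simp add: norm_abs_banach_lattice abs_le_iff)
    then have 1: "(1/2^n) * blinfun_apply \<bar>f n\<bar> (T e) \<le> (1/2^n) * (C * norm (T e))"
      by (intro mult_left_mono) auto
    \<comment> \<open>The disjoint term and the correction together dominate the positive part,
      because their sum is itself positive.\<close>
    have "pprt (h n - 4^n *\<^sub>R (\<Sum>i<n. h i)) \<le> w n + (1/2^n) *\<^sub>R e"
    proof (rule pprt_least)
      show "h n - 4^n *\<^sub>R (\<Sum>i<n. h i) \<le> w n + (1/2^n) *\<^sub>R e"
        unfolding diff_le_eq[symmetric] by (rule le_w)
      show "0 \<le> w n + (1/2^n) *\<^sub>R e"
        using \<open>0 \<le> e\<close> w(2) by (intro add_nonneg_nonneg scaleR_nonneg_nonneg) auto
    qed
    then have "T (pprt (h n - 4^n *\<^sub>R (\<Sum>i<n. h i))) \<le> T (w n + (1/2^n) *\<^sub>R e)"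
      by (rule positive_operator_mono[OF pos])
    also have "\<dots> = T (w n) + (1/2^n) *\<^sub>R T e"
      by (simp only: linear_add[OF lin] linear_scale[OF lin])
    finally have "blinfun_apply \<bar>f n\<bar> (T (pprt (h n - 4^n *\<^sub>R (\<Sum>i<n. h i))))
        \<le> blinfun_apply \<bar>f n\<bar> (T (w n) + (1/2^n) *\<^sub>R T e)"
      by (intro blinfun_mono_apply) simp
    then have 2: "\<epsilon> \<le> blinfun_apply \<bar>f n\<bar> (T (w n)) + (1/2^n) * blinfun_apply \<bar>f n\<bar> (T e)"
      using f(2)[of n] unfolding blinfun.add_right blinfun.scaleR_right by simp
    have "\<bar>f n\<bar> \<in> solid_hull V"
      using f(1) subset_solid_hull by (blast intro: abs_in_solid_hull)
    \<comment> \<open>Uniformity over \<open>solid_hull V\<close> is essential here, since the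
      functional \<open>\<bar>f n\<bar>\<close> varies with \<open>n\<close>.\<close>
    then have "\<bar>blinfun_apply \<bar>f n\<bar> (T (w n))\<bar> < \<epsilon>/2" using elim(1) by blast
    with 1 2 elim(2) show False by linarith
  qed
  then show False by simp
qed

theorem theorem3p1:
  fixes T :: "'a::banach_lattice \<Rightarrow> 'b::banach_lattice"
    and W :: "'a set" and V :: "('b \<Rightarrow>\<^sub>L real) set"
  assumes "positive_operator T"
    and "DW_DP_operator T"
    and "disjointly_weakly_compact W"
    and "disjointly_weakly_compact V"
  shows "(\<forall>x. disjoint_seq x \<and> range x \<subseteq> solid_hull W \<longrightarrow>
            (\<lambda>n. SUP f\<in>solid_hull V. ennreal \<bar>blinfun_apply f (T (x n))\<bar>) \<longlonglongrightarrow> 0)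
       \<and> (\<forall>\<epsilon>>0. \<exists>u\<ge>0. \<forall>x\<in>W. \<forall>f\<in>V. blinfun_apply \<bar>f\<bar> (T (pprt (\<bar>x\<bar> - u))) < \<epsilon>)"
  using DW_DP_disjoint_seq_uniform[OF assms] DW_DP_almost_order_bounded[OF assms] by blast

end
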